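(* Let $a$ be a nonnegative integer satisfying $a \le 66 - R_4(3)$, and let $q = a/24$. Then $R_n(3) \le n!(e-q)+1$ for all integers $n \ge 4$.
   Context: For an integer $n \ge 1$, the $n$-color Ramsey number $R_n(3) = R(3,\dots,3)$ denotes the smallest positive integer $N$ such that, for any coloring of the edges of the complete graph $K_N$ with $n$ colors, there is a monochromatic triangle. Here $e$ denotes the base of the natural logarithm. *)

theory Defs
  imports Complex_Main "HOL-Library.Ramsey"
begin

text \<open>
  The vertices of the complete graph on \<open>N\<close> vertices are \<open>{..<N}\<close>, its edges are the 2-element
  subsets, and the colors are \<open>{..<n}\<close>; \<^const>\<open>partn\<close> with these parameters says that every
  coloring of the edges has a monochromatic triangle.
\<close>

definition ramsey3 :: "nat \<Rightarrow> nat" where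
  "ramsey3 n = (LEAST N. N > 0 \<and> partn {..<N} 3 2 {..<n})"

text \<open>By Ramsey's theorem the minimum is attained, so the \<open>LEAST\<close> above is well defined.\<close>

lemma ramsey3_spec: "ramsey3 n > 0 \<and> partn {..<ramsey3 n} 3 2 {..<n}" if "n \<ge> 1"
proof -
  obtain N :: nat where N: "partn_lst {..<N} (replicate n 3) 2"
    using ramsey_full by blast
  then have p: "partn {..<N} 3 2 {..<n}"
    unfolding partn_lst_def partn_def by fastforce
  have "(\<lambda>_. 0) \<in> nsets {..<N} 2 \<rightarrow> {..<n}"
    using that by auto
  with p obtain H where "H \<in> nsets {..<N} 3"
    unfolding partn_def monochromatic_def by blast
  then have "N \<noteq> 0"
    by (cases N) (auto simp: nsets_def)
  with p have "\<exists>N>(0::nat). partn {..<N} 3 2 {..<n}"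
    by blast
  then show ?thesis
    unfolding ramsey3_def by (rule LeastI_ex)
qed

end

(* R_n - 1 is at most n! (1/0! + 1/1! + ... + 1/n! - q) for n >= 4. The hypothesis on a is the case
   n = 4, as 4! (1/0! + ... + 1/4!) = 65, and the Greenwood-Gleason recursion
   R_(n+1) - 1 <= (n+1) (R_n - 1) + 1 carries the bound from n to n + 1. *)
theory Submission
  imports Defs
begin

text \<open>A colouring \<open>f\<close> of the \<open>r\<close>-subsets of \<open>B\<close> is
  pulled back along \<open>h\<close> and recoloured through \<open>k\<close>, giving a colouring of
  \<open>A\<close> with colours in \<open>C\<close>. The \<open>h\<close>-image of a homogeneous set
  for it is homogeneous for \<open>f\<close>, because \<open>k\<close> is injective on
  \<open>D\<close>.\<close>

lemma partn_transfer:
  assumes p: "partn A m r C" and "r \<le> m"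
    and h: "inj_on h A" "h ` A \<subseteq> B" and k: "inj_on k D" "k ` D \<subseteq> C"
  shows "partn B m r D"
  unfolding partn_def monochromatic_def
proof
  fix f assume f: "f \<in> nsets B r \<rightarrow> D"
  have him: "h ` X \<in> nsets B j" if "X \<in> nsets A j" for X j
    using that h by (auto simp: nsets_def card_image inj_on_subset)
  have "(\<lambda>e. k (f (h ` e))) \<in> nsets A r \<rightarrow> C"
    using him f k(2) by fast
  then obtain H c where H: "H \<in> nsets A m" and c: "(\<lambda>e. k (f (h ` e))) ` nsets H r \<subseteq> {c}"
    using p unfolding partn_def monochromatic_def by blast
  have HA: "nsets H r \<subseteq> nsets A r"
    using H by (intro nsets_mono) (auto simp: nsets_def)
  obtain e where e: "e \<in> nsets H r"
    using H \<open>r \<le> m\<close> by (auto simp: nsets_def) (metis finite_subset obtain_subset_with_card_n)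
  have "bij_betw h H (h ` H)"
    using H h(1) by (auto simp: nsets_def bij_betw_def inj_on_subset)
  then have nsets_eq: "nsets (h ` H) r = (`) h ` nsets H r"
    using bij_betw_nsets bij_betw_imp_surj_on by metis
  have fD: "f (h ` d) \<in> D" if "d \<in> nsets H r" for d
    using that HA him f by blast
  have "f (h ` d) = f (h ` e)" if "d \<in> nsets H r" for d
    using inj_onD[OF k(1) _ fD[OF that] fD[OF e]] c that e by auto
  then have "f ` nsets (h ` H) r \<subseteq> {f (h ` e)}"
    by (auto simp: nsets_eq)
  then show "\<exists>\<xi>\<in>D. \<exists>H\<in>nsets B m. f ` nsets H r \<subseteq> {\<xi>}"
    using him[OF H] fD[OF e] by blast
qed

text \<open>Pigeonhole at vertex 0: some colour \<open>c\<close> occurs on at least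
  \<open>ramsey3 n\<close> of its edges. The far ends of these edges either span an edge of colour
  \<open>c\<close>, which closes a triangle with 0, or carry only the other \<open>n\<close>
  colours, so that they contain a monochromatic triangle.\<close>

lemma ramsey3_Suc_le:
  assumes "n \<ge> 1"
  shows "ramsey3 (Suc n) \<le> Suc n * (ramsey3 n - 1) + 2"
proof -
  define r where "r = ramsey3 n"
  define N where "N = Suc n * (r - 1) + 2"
  have r: "r > 0" "partn {..<r} 3 2 {..<n}"
    using ramsey3_spec[OF assms] by (auto simp: r_def)
  have "\<exists>c\<in>{..<Suc n}. \<exists>H\<in>nsets {..<N} 3. f ` nsets H 2 \<subseteq> {c}"
    if f: "f \<in> nsets {..<N} 2 \<rightarrow> {..<Suc n}" for f
  proof -
    define S where "S c = {v \<in> {1..<N}. f {0, v} = c}" for c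
    have col: "f {u, v} < Suc n" if "u < N" "v < N" "u \<noteq> v" for u v
    proof -
      have "{u, v} \<in> nsets {..<N} 2" using that by simp
      then show ?thesis using f by blast
    qed
    \<comment> \<open>Vertex 0 has \<open>N - 1 = Suc n * (r - 1) + 1\<close> neighbours, one more
      than \<open>Suc n\<close> classes of size at most \<open>r - 1\<close> can hold.\<close>
    have "\<exists>c<Suc n. r \<le> card (S c)"
    proof (rule ccontr)
      assume "\<not> ?thesis"
      then have small: "card (S c) \<le> r - 1" if "c < Suc n" for c
        using that by fastforce
      have "{1..<N} = (\<Union>c\<in>{..<Suc n}. S c)"
        using col by (auto simp: S_def)
      then have "card {1..<N} \<le> (\<Sum>c\<in>{..<Suc n}. card (S c))"
        using card_UN_le[of "{..<Suc n}" S] by (simp only: finite_lessThan)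
      also have "\<dots> \<le> (\<Sum>c\<in>{..<Suc n}. r - 1)"
        using small by (intro sum_mono) auto
      finally show False by (simp add: N_def)
    qed
    then obtain c where c: "c < Suc n" "r \<le> card (S c)" by blast
    have SN: "S c \<subseteq> {1..<N}" by (auto simp: S_def)
    show ?thesis
    proof (cases "\<exists>u\<in>S c. \<exists>v\<in>S c. u \<noteq> v \<and> f {u, v} = c")
      case True
      then obtain u v where uv: "u \<in> S c" "v \<in> S c" "u \<noteq> v" "f {u, v} = c" by blast
      \<comment> \<open>The three vertices are distinct because \<open>S c\<close> omits 0.\<close>
      have "{0, u, v} \<in> nsets {..<N} 3"
        using uv by (auto simp: nsets_def S_def)
      moreover have "f ` nsets {0, u, v} 2 \<subseteq> {c}"
      proof -
        have "nsets {0, u, v} 2 \<subseteq> {{0, u}, {0, v}, {u, v}}"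
          by (auto simp: nsets_def card_2_iff)
        then show ?thesis using uv by (fastforce simp: S_def)
      qed
      ultimately show ?thesis using c(1) by blast
    next
      case False
      have fS: "f \<in> nsets (S c) 2 \<rightarrow> {..<Suc n} - {c}"
      proof
        fix e assume e: "e \<in> nsets (S c) 2"
        then obtain u v where uv: "e = {u, v}" "u \<in> S c" "v \<in> S c" "u \<noteq> v"
          by (auto simp: nsets_def card_2_iff)
        then have "f e < Suc n"
          using SN col[of u v] by (auto simp: subset_iff)
        with False uv show "f e \<in> {..<Suc n} - {c}" by auto
      qed
      obtain h where h: "inj_on h {..<r}" "h ` {..<r} \<subseteq> S c"
        using card_le_inj[of "{..<r}" "S c"] c(2) SN finite_subset by fastforce
      have "partn (S c) 3 2 ({..<Suc n} - {c})"
      proof (rule partn_transfer[OF r(2) _ h])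
        show "2 \<le> (3::nat)" by simp
        \<comment> \<open>The colours other than \<open>c\<close> are relabelled by
          \<open>{..<n}\<close>: the top colour \<open>n\<close> takes over the free label
          \<open>c\<close>. If \<open>c = n\<close>, this is the identity.\<close>
        show "inj_on (\<lambda>x. if x = n then c else x) ({..<Suc n} - {c})"
          by (auto simp: inj_on_def)
        show "(\<lambda>x. if x = n then c else x) ` ({..<Suc n} - {c}) \<subseteq> {..<n}"
          using c(1) by auto
      qed
      with fS obtain H \<xi> where "H \<in> nsets (S c) 3" "\<xi> \<in> {..<Suc n} - {c}" "f ` nsets H 2 \<subseteq> {\<xi>}"
        unfolding partn_def monochromatic_def by blast
      moreover have "nsets (S c) 3 \<subseteq> nsets {..<N} 3"
        using SN by (intro nsets_mono) auto
      ultimately show ?thesis by blast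
    qed
  qed
  then have "N > 0 \<and> partn {..<N} 3 2 {..<Suc n}"
    by (auto simp: partn_def monochromatic_def N_def)
  then have "ramsey3 (Suc n) \<le> N"
    unfolding ramsey3_def by (rule Least_le)
  then show ?thesis by (simp add: N_def r_def)
qed

theorem proposition2p7:
  fixes a :: nat and q :: real
  assumes "int a \<le> 66 - int (ramsey3 4)"
    and "q = real a / 24"
  shows "\<forall>n\<ge>4. real (ramsey3 n) \<le> fact n * (exp 1 - q) + 1"
proof (intro allI impI)
  fix n :: nat assume n: "n \<ge> 4"
  have "real (ramsey3 n) - 1 \<le> fact n * ((\<Sum>k\<le>n. 1 / fact k) - q)"
    using n
  proof (induction n rule: dec_induct)
    case base
    have "real (ramsey3 4) \<le> 66 - real a"
      using assms(1) by linarith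
    \<comment> \<open>Since \<open>4! * q = a\<close>, the goal reads
      \<open>ramsey3 4 - 1 \<le> 65 - a\<close>.\<close>
    then show ?case
      using assms(2) by (simp add: eval_nat_numeral field_simps)
  next
    case (step n)
    \<comment> \<open>Positivity makes the truncated subtraction \<open>ramsey3 n - 1\<close> agree
      with the real one.\<close>
    have "ramsey3 n > 0"
      using ramsey3_spec[of n] step.hyps by simp
    have "real (ramsey3 (Suc n)) \<le> real (Suc n * (ramsey3 n - 1) + 2)"
      using ramsey3_Suc_le[of n] step.hyps by (simp only: of_nat_le_iff)
    also have "\<dots> = real (Suc n) * (real (ramsey3 n) - 1) + 2"
      using \<open>ramsey3 n > 0\<close> by (simp only: of_nat_add of_nat_mult of_nat_diff Suc_leI One_nat_def) simp
    also have "\<dots> \<le> real (Suc n) * (fact n * ((\<Sum>k\<le>n. 1 / fact k) - q)) + 2"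
      using step.IH by (intro add_right_mono mult_left_mono) auto
    also have "\<dots> = fact (Suc n) * ((\<Sum>k\<le>n. 1 / fact k) - q) + 2"
      by (simp add: mult.assoc)
    \<comment> \<open>The new summand contributes
      \<open>fact (Suc n) * (1 / fact (Suc n)) = 1\<close>, which absorbs one unit of the 2.\<close>
    also have "\<dots> = fact (Suc n) * ((\<Sum>k\<le>Suc n. 1 / fact k) - q) + 1"
      by (simp add: ring_distribs del: fact_Suc)
    finally show ?case by simp
  qed
  also have "\<dots> \<le> fact n * (exp 1 - q)"
  proof -
    \<comment> \<open>A partial sum of the exponential series at 1 is at most its limit, as all
      terms are nonnegative.\<close>
    have "(\<Sum>k\<le>n. 1 / fact k) \<le> (\<Sum>k. 1 / fact k :: real)"
      using summable_exp[of "1::real"]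
      by (intro sum_le_suminf) (auto simp: divide_inverse)
    also have "\<dots> = exp 1"
      by (simp add: exp_def divide_inverse)
    finally show ?thesis
      by (intro mult_left_mono) auto
  qed
  finally show "real (ramsey3 n) \<le> fact n * (exp 1 - q) + 1" by simp
qed

end
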